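(* Let $x$ and $y$ be BARTC terms. If $\mathrm{BARTC}\vdash x=y$, then $x\sim_s^{fr}y$ (FR step bisimilarity).
   Context: Events. $\langle\mathbb E,\le,\sharp,\lambda\rangle$ is a prime event structure: $\mathbb E$ is a denumerable set of events, $\lambda:\mathbb E\to\Lambda$ a labelling, $\le$ (causality) a partial order with $\{e'\mid e'\le e\}$ finite for every $e$, and $\sharp$ (conflict) an irreflexive symmetric relation such that $e\sharp e'\le e''$ implies $e\sharp e''$. Two events are concurrent if they are related by none of $\le,\ge,\sharp$. For $e\in\mathbb E$, $m\in\mathbb N$, $e[m]$ denotes the past (history) of $e$; $\mathbb E$ is extended by all histories. $X[\mathcal K]$ ($\mathcal K\subseteq\mathbb N$) contains for each $e\in X$ a history $e[m]$ with $m\in\mathcal K$. $X\sim Y$ means $X,Y$ are isomorphic as pomsets (labelled partial orders). Everything is image finite. BARTC terms are built from variables and constants (events $e$ and histories $e[m]$) with the binary operators $\cdot$ (causality) and $+$ (conflict); closed terms have no variables. $Std(x)$: $x$ contains only events, no histories; $NStd(x)$: $x$ contains only histories. $\mathrm{BARTC}\vdash x=y$ means derivability in equational logic from: (A1) $x+y=y+x$; (A2) $(x+y)+z=x+(y+z)$; (A3) $x+x=x$; (A41) $(x+y)\cdot z=x\cdot z+y\cdot z$ if $Std(x),Std(y),Std(z)$; (A42) $x\cdot(y+z)=x\cdot y+x\cdot z$ if $NStd(x),NStd(y),NStd(z)$; (A5) $(x\cdot y)\cdot z=x\cdot(y\cdot z)$. Step transitions. $\xrightarrow{X}$ is forward,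 $\overset{X[\mathcal K]}{\twoheadrightarrow}$ is reverse; labels are nonempty pomsets whose events are pairwise concurrent, and $X\subseteq x$ means the events of $X$ occur in $x$. Forward rules: $X\xrightarrow{X}X[\mathcal K]$; if $x\xrightarrow{X}u$ with $X\subseteq x$ ($u$ is $X[\mathcal K]$ or a term $x'$), then $x+y\xrightarrow{X}u$, $y+x\xrightarrow{X}u$ and $x\cdot y\xrightarrow{X}u\cdot y$. Reverse rules: $X[\mathcal K]\overset{X[\mathcal K]}{\twoheadrightarrow}X$; if $x\overset{X[\mathcal K]}{\twoheadrightarrow}u$ with $X\subseteq x$ ($u$ is $X$ or a term $x'$), then $x+y\overset{X[\mathcal K]}{\twoheadrightarrow}u$, $y+x\overset{X[\mathcal K]}{\twoheadrightarrow}u$ and $y\cdot x\overset{X[\mathcal K]}{\twoheadrightarrow}y\cdot u$. An FR step bisimulation is a relation $R$ on states (process terms) such that for $(s,t)\in R$: (1) for every step $s\xrightarrow{X_1}s'$ there is a step $t\xrightarrow{X_2}t'$ with $X_2\sim X_1$ and $(s',t')\in R$, and vice versa; (2) for every reverse step $s\overset{X_1[\mathcal K_1]}{\twoheadrightarrow}s'$ there is a reverse step $t\overset{X_2[\mathcal K_2]}{\twoheadrightarrow}t'$ with $X_2\sim X_1$ and $(s',t')\in R$, and vice versa. $x\sim_s^{fr}y$ iff some FR step bisimulation contains $(x,y)$; for terms with variables this is required of all closed substitution instances. *)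

theory Defs
  imports Complex_Main "HOL-Library.Countable_Set"
begin

section \<open>Prime event structures, steps and histories\<close>

record ('e, 'l) event_structure =
  events :: "'e set"
  causality :: "('e \<times> 'e) set"
  conflict :: "('e \<times> 'e) set"
  labelling :: "'e \<Rightarrow> 'l"

text \<open>Countable includes finite, so both readings of a denumerable set of events are covered.\<close>

definition prime_event_structure :: "('e, 'l) event_structure \<Rightarrow> bool" where
  "prime_event_structure E \<longleftrightarrow>
     countable (events E) \<and>
     partial_order_on (events E) (causality E) \<and>
     (\<forall>e \<in> events E. finite {e'. (e', e) \<in> causality E}) \<and>
     conflict E \<subseteq> events E \<times> events E \<and>
     irrefl (conflict E) \<and> sym (conflict E) \<and>
     (\<forall>e e' e''. (e, e') \<in> conflict E \<longrightarrow> (e', e'') \<in> causality E \<longrightarrow> (e, e'') \<in> conflict E)"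

definition concurrent :: "('e, 'l) event_structure \<Rightarrow> 'e \<Rightarrow> 'e \<Rightarrow> bool" where
  "concurrent E e e' \<longleftrightarrow>
     (e, e') \<notin> causality E \<and> (e', e) \<notin> causality E \<and> (e, e') \<notin> conflict E"

definition is_step :: "('e, 'l) event_structure \<Rightarrow> 'e set \<Rightarrow> bool" where
  "is_step E X \<longleftrightarrow> X \<noteq> {} \<and> X \<subseteq> events E \<and> pairwise (concurrent E) X"

text \<open>A set of events is a pomset with the causality and the labels inherited from \<open>E\<close>.\<close>

definition pomset_iso :: "('e, 'l) event_structure \<Rightarrow> 'e set \<Rightarrow> 'e set \<Rightarrow> bool" where
  "pomset_iso E X Y \<longleftrightarrow>
     (\<exists>f. bij_betw f X Y \<and>
          (\<forall>e \<in> X. labelling E (f e) = labelling E e) \<and>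
          (\<forall>e \<in> X. \<forall>e' \<in> X. (f e, f e') \<in> causality E \<longleftrightarrow> (e, e') \<in> causality E))"

text \<open>The history \<open>e[m]\<close> is the pair \<open>(e, m)\<close>. The notation \<open>X[K]\<close> does not determine
  which key in \<open>K\<close> is used for which event, so \<open>pasts X K\<close> is the set of all possible
  values of \<open>X[K]\<close>: one history \<open>e[m]\<close> with \<open>m \<in> K\<close> for each \<open>e \<in> X\<close>.\<close>

definition pasts :: "'e set \<Rightarrow> nat set \<Rightarrow> ('e \<times> nat) set set" where
  "pasts X K = {H. bij_betw fst H X \<and> snd ` H \<subseteq> K}"

section \<open>BARTC terms\<close>

text \<open>The transition axioms \<open>X \<rightarrow> X[K]\<close> and \<open>X[K] \<rightarrow> X\<close> use a step \<open>X\<close> and its past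
  \<open>X[K]\<close> as process terms, so these are the constants. The event constant \<open>e\<close> is the
  singleton step and the history constant \<open>e[m]\<close> is the singleton past; terms built from
  these alone form a subclass closed under derivability and under transitions.\<close>

datatype ('e, 'v) bterm =
    Var 'v
  | Step "'e set"
  | Past "('e \<times> nat) set"
  | Seq "('e, 'v) bterm" "('e, 'v) bterm"  (infixr \<open>\<odot>\<close> 75)
  | Alt "('e, 'v) bterm" "('e, 'v) bterm"  (infixr \<open>\<oplus>\<close> 65)

abbreviation Event :: "'e \<Rightarrow> ('e, 'v) bterm" where
  "Event e \<equiv> Step {e}"

abbreviation History :: "'e \<Rightarrow> nat \<Rightarrow> ('e, 'v) bterm" where
  "History e m \<equiv> Past {(e, m)}"

fun bartc_term :: "('e, 'l) event_structure \<Rightarrow> ('e, 'v) bterm \<Rightarrow> bool" where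
  "bartc_term E (Var v) \<longleftrightarrow> True"
| "bartc_term E (Step X) \<longleftrightarrow> is_step E X"
| "bartc_term E (Past H) \<longleftrightarrow> (\<exists>X K. is_step E X \<and> H \<in> pasts X K)"
| "bartc_term E (x \<odot> y) \<longleftrightarrow> bartc_term E x \<and> bartc_term E y"
| "bartc_term E (x \<oplus> y) \<longleftrightarrow> bartc_term E x \<and> bartc_term E y"

fun closed_term :: "('e, 'v) bterm \<Rightarrow> bool" where
  "closed_term (Var v) \<longleftrightarrow> False"
| "closed_term (Step X) \<longleftrightarrow> True"
| "closed_term (Past H) \<longleftrightarrow> True"
| "closed_term (x \<odot> y) \<longleftrightarrow> closed_term x \<and> closed_term y"
| "closed_term (x \<oplus> y) \<longleftrightarrow> closed_term x \<and> closed_term y"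

definition processes :: "('e, 'l) event_structure \<Rightarrow> ('e, 'v) bterm set" where
  "processes E = {t. bartc_term E t \<and> closed_term t}"

fun subst :: "('v \<Rightarrow> ('e, 'v) bterm) \<Rightarrow> ('e, 'v) bterm \<Rightarrow> ('e, 'v) bterm" where
  "subst \<sigma> (Var v) = \<sigma> v"
| "subst \<sigma> (Step X) = Step X"
| "subst \<sigma> (Past H) = Past H"
| "subst \<sigma> (x \<odot> y) = subst \<sigma> x \<odot> subst \<sigma> y"
| "subst \<sigma> (x \<oplus> y) = subst \<sigma> x \<oplus> subst \<sigma> y"

text \<open>An event occurs in a term also when it occurs there as a history: otherwise the side
  condition \<open>X \<subseteq> x\<close> of the reverse rules would fail for a term of histories.\<close>

fun occ :: "('e, 'v) bterm \<Rightarrow> 'e set" where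
  "occ (Var v) = {}"
| "occ (Step X) = X"
| "occ (Past H) = fst ` H"
| "occ (x \<odot> y) = occ x \<union> occ y"
| "occ (x \<oplus> y) = occ x \<union> occ y"

text \<open>A variable may be replaced by events as well as by histories, so a term with variables
  contains neither only events nor only histories.\<close>

fun Std :: "('e, 'v) bterm \<Rightarrow> bool" where
  "Std (Var v) \<longleftrightarrow> False"
| "Std (Step X) \<longleftrightarrow> True"
| "Std (Past H) \<longleftrightarrow> False"
| "Std (x \<odot> y) \<longleftrightarrow> Std x \<and> Std y"
| "Std (x \<oplus> y) \<longleftrightarrow> Std x \<and> Std y"

fun NStd :: "('e, 'v) bterm \<Rightarrow> bool" where
  "NStd (Var v) \<longleftrightarrow> False"
| "NStd (Step X) \<longleftrightarrow> False"
| "NStd (Past H) \<longleftrightarrow> True"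
| "NStd (x \<odot> y) \<longleftrightarrow> NStd x \<and> NStd y"
| "NStd (x \<oplus> y) \<longleftrightarrow> NStd x \<and> NStd y"

section \<open>Derivability\<close>

text \<open>The axioms are schemes over all terms, so their substitution instances are included.
  Every axiom has the same constants on both sides, so a term derivably equal to a
  \<open>bartc_term\<close> is one itself and no separate well-formedness condition is needed here.\<close>

inductive BARTC :: "('e, 'v) bterm \<Rightarrow> ('e, 'v) bterm \<Rightarrow> bool"
  (\<open>BARTC \<turnstile> _ \<approx> _\<close> [51, 51] 50) where
  refl: "BARTC \<turnstile> x \<approx> x"
| sym: "BARTC \<turnstile> x \<approx> y \<Longrightarrow> BARTC \<turnstile> y \<approx> x"
| trans: "BARTC \<turnstile> x \<approx> y \<Longrightarrow> BARTC \<turnstile> y \<approx> z \<Longrightarrow> BARTC \<turnstile> x \<approx> z"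
| cong_seq: "BARTC \<turnstile> x \<approx> x' \<Longrightarrow> BARTC \<turnstile> y \<approx> y' \<Longrightarrow> BARTC \<turnstile> x \<odot> y \<approx> x' \<odot> y'"
| cong_alt: "BARTC \<turnstile> x \<approx> x' \<Longrightarrow> BARTC \<turnstile> y \<approx> y' \<Longrightarrow> BARTC \<turnstile> x \<oplus> y \<approx> x' \<oplus> y'"
| A1: "BARTC \<turnstile> x \<oplus> y \<approx> y \<oplus> x"
| A2: "BARTC \<turnstile> (x \<oplus> y) \<oplus> z \<approx> x \<oplus> (y \<oplus> z)"
| A3: "BARTC \<turnstile> x \<oplus> x \<approx> x"
| A41: "Std x \<Longrightarrow> Std y \<Longrightarrow> Std z \<Longrightarrow> BARTC \<turnstile> (x \<oplus> y) \<odot> z \<approx> x \<odot> z \<oplus> y \<odot> z"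
| A42: "NStd x \<Longrightarrow> NStd y \<Longrightarrow> NStd z \<Longrightarrow> BARTC \<turnstile> x \<odot> (y \<oplus> z) \<approx> x \<odot> y \<oplus> x \<odot> z"
| A5: "BARTC \<turnstile> (x \<odot> y) \<odot> z \<approx> x \<odot> (y \<odot> z)"

section \<open>Step transitions\<close>

inductive fstep ::
  "('e, 'l) event_structure \<Rightarrow> ('e, 'v) bterm \<Rightarrow> 'e set \<Rightarrow> ('e, 'v) bterm \<Rightarrow> bool"
  for E :: "('e, 'l) event_structure" where
  fstep_const: "is_step E X \<Longrightarrow> H \<in> pasts X K \<Longrightarrow> fstep E (Step X) X (Past H)"
| fstep_alt1: "fstep E x X u \<Longrightarrow> X \<subseteq> occ x \<Longrightarrow> fstep E (x \<oplus> y) X u"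
| fstep_alt2: "fstep E x X u \<Longrightarrow> X \<subseteq> occ x \<Longrightarrow> fstep E (y \<oplus> x) X u"
| fstep_seq: "fstep E x X u \<Longrightarrow> X \<subseteq> occ x \<Longrightarrow> fstep E (x \<odot> y) X (u \<odot> y)"

inductive rstep ::
  "('e, 'l) event_structure \<Rightarrow> ('e, 'v) bterm \<Rightarrow> ('e \<times> nat) set \<Rightarrow> ('e, 'v) bterm \<Rightarrow> bool"
  for E :: "('e, 'l) event_structure" where
  rstep_const: "is_step E X \<Longrightarrow> H \<in> pasts X K \<Longrightarrow> rstep E (Past H) H (Step X)"
| rstep_alt1: "rstep E x H u \<Longrightarrow> H \<in> pasts X K \<Longrightarrow> X \<subseteq> occ x \<Longrightarrow> rstep E (x \<oplus> y) H u"
| rstep_alt2: "rstep E x H u \<Longrightarrow> H \<in> pasts X K \<Longrightarrow> X \<subseteq> occ x \<Longrightarrow> rstep E (y \<oplus> x) H u"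
| rstep_seq: "rstep E x H u \<Longrightarrow> H \<in> pasts X K \<Longrightarrow> X \<subseteq> occ x \<Longrightarrow> rstep E (y \<odot> x) H (y \<odot> u)"

section \<open>FR step bisimilarity\<close>

text \<open>Image finiteness is not imposed: a step leads to \<open>X[K]\<close> for every \<open>K\<close>, hence to
  infinitely many pasts if \<open>K\<close> is not restricted.\<close>

definition fr_step_bisimulation ::
  "('e, 'l) event_structure \<Rightarrow> (('e, 'v) bterm \<times> ('e, 'v) bterm) set \<Rightarrow> bool" where
  "fr_step_bisimulation E R \<longleftrightarrow>
     R \<subseteq> processes E \<times> processes E \<and>
     (\<forall>s t. (s, t) \<in> R \<longrightarrow>
        (\<forall>X1 s'. fstep E s X1 s' \<longrightarrow>
           (\<exists>X2 t'. fstep E t X2 t' \<and> pomset_iso E X2 X1 \<and> (s', t') \<in> R)) \<and>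
        (\<forall>X2 t'. fstep E t X2 t' \<longrightarrow>
           (\<exists>X1 s'. fstep E s X1 s' \<and> pomset_iso E X1 X2 \<and> (s', t') \<in> R)) \<and>
        (\<forall>X1 K1 H1 s'. H1 \<in> pasts X1 K1 \<and> rstep E s H1 s' \<longrightarrow>
           (\<exists>X2 K2 H2 t'. H2 \<in> pasts X2 K2 \<and> rstep E t H2 t' \<and>
              pomset_iso E X2 X1 \<and> (s', t') \<in> R)) \<and>
        (\<forall>X2 K2 H2 t'. H2 \<in> pasts X2 K2 \<and> rstep E t H2 t' \<longrightarrow>
           (\<exists>X1 K1 H1 s'. H1 \<in> pasts X1 K1 \<and> rstep E s H1 s' \<and>
              pomset_iso E X1 X2 \<and> (s', t') \<in> R)))"

definition fr_step_bisimilar_closed ::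
  "('e, 'l) event_structure \<Rightarrow> ('e, 'v) bterm \<Rightarrow> ('e, 'v) bterm \<Rightarrow> bool" where
  "fr_step_bisimilar_closed E s t \<longleftrightarrow> (\<exists>R. fr_step_bisimulation E R \<and> (s, t) \<in> R)"

definition fr_step_bisimilar ::
  "('e, 'l) event_structure \<Rightarrow> ('e, 'v) bterm \<Rightarrow> ('e, 'v) bterm \<Rightarrow> bool" where
  "fr_step_bisimilar E x y \<longleftrightarrow>
     (\<forall>\<sigma>. (\<forall>v. \<sigma> v \<in> processes E) \<longrightarrow>
          fr_step_bisimilar_closed E (subst \<sigma> x) (subst \<sigma> y))"

end

theory Submission
  imports Defs
begin

text \<open>Derivable equality of processes is itself an FR step bisimulation: by induction on the
  derivation, derivably equal terms have steps with the same label leading to derivably equal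
  terms. In A41 the operand \<open>z\<close> is standard, so that neither side can reverse; in A42 the
  operand \<open>x\<close> is a term of histories, so that neither side can go forward.\<close>

text \<open>This and \<open>rstep_occ\<close> make the occurrence side conditions of the transition
  rules automatic, so the inversion equivalences for sums and products can drop them.\<close>

lemma fstep_occ: "fstep E x X u \<Longrightarrow> X \<subseteq> occ x"
  by (induction rule: fstep.induct) auto

lemma rstep_occ: "rstep E x H u \<Longrightarrow> \<exists>X K. H \<in> pasts X K \<and> X \<subseteq> occ x"
proof (induction rule: rstep.induct)
  case (rstep_const X H K)
  then have "fst ` H = X" by (simp add: pasts_def bij_betw_def)
  with rstep_const show ?case by auto
qed auto

lemma fstep_Alt_iff: "fstep E (x \<oplus> y) X u \<longleftrightarrow> fstep E x X u \<or> fstep E y X u"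
  by (subst fstep.simps) (auto dest: fstep_occ)

lemma fstep_Seq_iff: "fstep E (x \<odot> y) X w \<longleftrightarrow> (\<exists>u. fstep E x X u \<and> w = u \<odot> y)"
  by (subst fstep.simps) (auto dest: fstep_occ)

lemma rstep_Alt_iff: "rstep E (x \<oplus> y) H u \<longleftrightarrow> rstep E x H u \<or> rstep E y H u"
  by (subst rstep.simps) (simp, blast dest: rstep_occ)

lemma rstep_Seq_iff: "rstep E (x \<odot> y) H w \<longleftrightarrow> (\<exists>u. rstep E y H u \<and> w = x \<odot> u)"
  by (subst rstep.simps) (simp, blast dest: rstep_occ)

text \<open>Every reverse step ultimately undoes a \<open>Past\<close> constant inside
  \<open>x\<close>.\<close>

lemma rstep_not_Std: "rstep E x H u \<Longrightarrow> \<not> Std x"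
  by (induction rule: rstep.induct) auto

lemma fstep_not_NStd: "fstep E x X u \<Longrightarrow> \<not> NStd x"
  by (induction rule: fstep.induct) auto

lemma fstep_processes: "fstep E x X u \<Longrightarrow> x \<in> processes E \<Longrightarrow> u \<in> processes E"
  by (induction rule: fstep.induct) (auto simp: processes_def)

lemma rstep_processes: "rstep E x H u \<Longrightarrow> x \<in> processes E \<Longrightarrow> u \<in> processes E"
  by (induction rule: rstep.induct) (auto simp: processes_def)

lemma subst_Std: "Std x \<Longrightarrow> subst \<sigma> x = x"
  by (induction x) auto

lemma subst_NStd: "NStd x \<Longrightarrow> subst \<sigma> x = x"
  by (induction x) auto

lemma subst_processes:
  assumes "\<And>v. \<sigma> v \<in> processes E" and "bartc_term E x"
  shows "subst \<sigma> x \<in> processes E"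
  using assms(2) by (induction x) (use assms(1) in \<open>auto simp: processes_def\<close>)

text \<open>The side conditions of A41 and A42 exclude variables, so their operands are fixed by
  \<open>\<sigma>\<close> and the same axiom applies again.\<close>

lemma BARTC_subst: "BARTC \<turnstile> x \<approx> y \<Longrightarrow> BARTC \<turnstile> subst \<sigma> x \<approx> subst \<sigma> y"
proof (induction rule: BARTC.induct)
  case (sym x y)
  then show ?case by (blast intro: BARTC.sym)
next
  case (trans x y z)
  then show ?case by (blast intro: BARTC.trans)
qed (simp_all add: subst_Std subst_NStd BARTC.refl BARTC.cong_seq BARTC.cong_alt
    BARTC.A1 BARTC.A2 BARTC.A3 BARTC.A41 BARTC.A42 BARTC.A5)

text \<open>Both directions are proved together so that the symmetry case can swap them. A product
  keeps its right operand after a step: congruence relates the residuals of \<open>cong_seq\<close>,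
  A5 those of A5, and those of A41 coincide.\<close>

lemma BARTC_fstep:
  assumes "BARTC \<turnstile> x \<approx> y"
  shows "(\<forall>X u. fstep E x X u \<longrightarrow> (\<exists>v. fstep E y X v \<and> BARTC \<turnstile> u \<approx> v)) \<and>
         (\<forall>X v. fstep E y X v \<longrightarrow> (\<exists>u. fstep E x X u \<and> BARTC \<turnstile> u \<approx> v))"
  using assms
proof (induction rule: BARTC.induct)
  case (sym x y)
  then show ?case by (meson BARTC.sym)
next
  case (trans x y z)
  then show ?case by (meson BARTC.trans)
next
  \<comment> \<open>A step of \<open>x\<close> would leave \<open>u \<odot> (y \<oplus> z)\<close>
    on the left, but \<open>u \<odot> y\<close> or \<open>u \<odot> z\<close> on the right.\<close>
  case (A42 x y z)
  then show ?case by (auto simp: fstep_Alt_iff fstep_Seq_iff dest: fstep_not_NStd)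
qed (fastforce simp: fstep_Alt_iff fstep_Seq_iff
    intro: BARTC.refl BARTC.cong_seq BARTC.A5)+

text \<open>Dual to \<open>BARTC_fstep\<close>: reversal acts on the right operand of a product, so
  now the residuals of A42 coincide and A41 is the vacuous case.\<close>

lemma BARTC_rstep:
  assumes "BARTC \<turnstile> x \<approx> y"
  shows "(\<forall>H u. rstep E x H u \<longrightarrow> (\<exists>v. rstep E y H v \<and> BARTC \<turnstile> u \<approx> v)) \<and>
         (\<forall>H v. rstep E y H v \<longrightarrow> (\<exists>u. rstep E x H u \<and> BARTC \<turnstile> u \<approx> v))"
  using assms
proof (induction rule: BARTC.induct)
  case (sym x y)
  then show ?case by (meson BARTC.sym)
next
  case (trans x y z)
  then show ?case by (meson BARTC.trans)
next
  case (A41 x y z)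
  then show ?case by (auto simp: rstep_Alt_iff rstep_Seq_iff dest: rstep_not_Std)
qed (fastforce simp: rstep_Alt_iff rstep_Seq_iff
    intro: BARTC.refl BARTC.cong_seq BARTC.A5)+

lemma pomset_iso_refl: "pomset_iso E X X"
  unfolding pomset_iso_def by (rule exI[of _ id]) simp

text \<open>Steps are answered with the very same label, so the identity serves as pomset
  isomorphism; residuals of processes are again processes.\<close>

lemma fr_step_bisimulation_BARTC:
  "fr_step_bisimulation E {(s, t). s \<in> processes E \<and> t \<in> processes E \<and> BARTC \<turnstile> s \<approx> t}"
  (is "fr_step_bisimulation E ?R")
  unfolding fr_step_bisimulation_def
proof (intro conjI allI impI)
  show "?R \<subseteq> processes E \<times> processes E" by auto
next
  fix s t X s'
  assume "(s, t) \<in> ?R" "fstep E s X s'"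
  then show "\<exists>X2 t'. fstep E t X2 t' \<and> pomset_iso E X2 X \<and> (s', t') \<in> ?R"
    using BARTC_fstep[of s t E] fstep_processes pomset_iso_refl by blast
next
  fix s t X t'
  assume "(s, t) \<in> ?R" "fstep E t X t'"
  then show "\<exists>X1 s'. fstep E s X1 s' \<and> pomset_iso E X1 X \<and> (s', t') \<in> ?R"
    using BARTC_fstep[of s t E] fstep_processes pomset_iso_refl by blast
next
  fix s t X K H s'
  assume "(s, t) \<in> ?R" "H \<in> pasts X K \<and> rstep E s H s'"
  then show "\<exists>X2 K2 H2 t'. H2 \<in> pasts X2 K2 \<and> rstep E t H2 t' \<and>
      pomset_iso E X2 X \<and> (s', t') \<in> ?R"
    using BARTC_rstep[of s t E] rstep_processes pomset_iso_refl by blast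
next
  fix s t X K H t'
  assume "(s, t) \<in> ?R" "H \<in> pasts X K \<and> rstep E t H t'"
  then show "\<exists>X1 K1 H1 s'. H1 \<in> pasts X1 K1 \<and> rstep E s H1 s' \<and>
      pomset_iso E X1 X \<and> (s', t') \<in> ?R"
    using BARTC_rstep[of s t E] rstep_processes pomset_iso_refl by blast
qed

theorem theorem3p7:
  fixes E :: "('e, 'l) event_structure"
    and x y :: "('e, 'v) bterm"
  assumes "prime_event_structure E"
    and "bartc_term E x" and "bartc_term E y"
    and "BARTC \<turnstile> x \<approx> y"
  shows "fr_step_bisimilar E x y"
  unfolding fr_step_bisimilar_def fr_step_bisimilar_closed_def
proof (intro allI impI exI conjI)
  fix \<sigma> :: "'v \<Rightarrow> ('e, 'v) bterm"
  assume \<sigma>: "\<forall>v. \<sigma> v \<in> processes E"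
  \<comment> \<open>This fixes the witness for the bisimulation: derivable equality on processes,
    the same for every \<open>\<sigma>\<close>.\<close>
  show "(subst \<sigma> x, subst \<sigma> y)
      \<in> {(s, t). s \<in> processes E \<and> t \<in> processes E \<and> BARTC \<turnstile> s \<approx> t}"
    using \<sigma> assms by (simp add: subst_processes BARTC_subst)
qed (rule fr_step_bisimulation_BARTC)

end
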